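(* Let $S\subseteq \mathbb{Z}^{+}$ with $1\in S$, and write $S\setminus\{1\}=\{k_1,k_2,\dots\}$ (a finite or infinite set of integers $k_i>1$). Then the infinite matrix $\mathbb{M}_S=\left[{n\brace k}_S\right]_{n,k\ge 0}$ is an exponential Riordan matrix, given by $$\mathbb{M}_S=\left\langle 1,\; x+\sum_{i\ge 1}\frac{x^{k_i}}{k_i!}\right\rangle .$$
   Context: $\mathbb{Z}^{+}$ is the set of positive integers. For $S\subseteq\mathbb{Z}^{+}$, ${n\brace k}_S$ denotes the number of partitions of $[n]=\{1,\dots,n\}$ into exactly $k$ (non-empty) blocks such that the size of each block belongs to $S$ (so ${0\brace 0}_S=1$). An infinite lower triangular matrix $[d_{n,k}]_{n,k\ge 0}$ is called an exponential Riordan array (or matrix) if there are formal power series $g(x),f(x)$ with $g(0)\ne 0$, $f(0)=0$, $f'(0)\neq 0$ such that for every $k\ge 0$ the exponential generating function of column $k$ is $\sum_{n\ge 0} d_{n,k}\frac{x^n}{n!}=g(x)\frac{f(x)^k}{k!}$; this matrix is denoted $\langle g(x),f(x)\rangle$. *)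

theory Defs
  imports
    "HOL-Analysis.Infinite_Sum"
    "HOL-Computational_Algebra.Formal_Power_Series"
    "HOL-Library.Disjoint_Sets"
begin

definition restricted_Stirling :: "nat set \<Rightarrow> nat \<Rightarrow> nat \<Rightarrow> nat" where
  "restricted_Stirling S n k =
     card {P. partition_on {1..n} P \<and> card P = k \<and> (\<forall>B\<in>P. card B \<in> S)}"

definition restricted_Stirling_matrix ::
    "nat set \<Rightarrow> nat \<Rightarrow> nat \<Rightarrow> 'a::field_char_0" where
  "restricted_Stirling_matrix S = (\<lambda>n k. of_nat (restricted_Stirling S n k))"

definition egf :: "(nat \<Rightarrow> 'a::field_char_0) \<Rightarrow> 'a fps" where
  "egf a = Abs_fps (\<lambda>n. a n / fact n)"

definition riordan_pair :: "'a::field_char_0 fps \<Rightarrow> 'a fps \<Rightarrow> bool" where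
  "riordan_pair g f \<longleftrightarrow>
     fps_nth g 0 \<noteq> 0 \<and> fps_nth f 0 = 0 \<and> fps_nth (fps_deriv f) 0 \<noteq> 0"

definition exp_riordan_matrix :: "(nat \<Rightarrow> nat \<Rightarrow> 'a::field_char_0) \<Rightarrow> bool" where
  "exp_riordan_matrix d \<longleftrightarrow>
     (\<forall>n k. n < k \<longrightarrow> d n k = 0) \<and>
     (\<exists>g f. riordan_pair g f \<and> (\<forall>k. egf (\<lambda>n. d n k) = g * f ^ k * fps_const (1 / fact k)))"

text \<open>
  The matrix written \<open>\<langle>g, f\<rangle>\<close>: its entry at \<open>(n, k)\<close> is \<open>n!\<close> times the coefficient of
  \<open>x ^ n\<close> in \<open>g(x) f(x) ^ k / k!\<close>. The definition is total; the notation is only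
  meaningful as an exponential Riordan matrix when \<open>riordan_pair g f\<close> holds.
\<close>

definition exp_riordan :: "'a::field_char_0 fps \<Rightarrow> 'a fps \<Rightarrow> nat \<Rightarrow> nat \<Rightarrow> 'a" where
  "exp_riordan g f = (\<lambda>n k. fact n * fps_nth (g * f ^ k * fps_const (1 / fact k)) n)"

lemma eq_exp_riordan_iff:
  "d = exp_riordan g f \<longleftrightarrow> (\<forall>k. egf (\<lambda>n. d n k) = g * f ^ k * fps_const (1 / fact k))"
  by (auto simp: exp_riordan_def egf_def fps_eq_iff fun_eq_iff field_simps)

text \<open>
  Infinite sums of formal power series (\<open>infsum\<close>, \<open>has_sum\<close>) refer to the library's metric
  on \<open>'a fps\<close>, i.e. to formal convergence. The following shows that a series of
  distinct monomials always converges, to the series with the expected coefficients, so the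
  default value \<open>0\<close> of \<open>infsum\<close> for divergent sums plays no role.
\<close>

lemma has_sum_fps_monomials:
  fixes c :: "nat \<Rightarrow> 'a::field_char_0"
  shows "((\<lambda>k. fps_const (c k) * fps_X ^ k) has_sum Abs_fps (\<lambda>n. if n \<in> A then c n else 0)) A"
proof -
  let ?F = "Abs_fps (\<lambda>n. if n \<in> A then c n else 0)"
  let ?s = "\<lambda>Y. \<Sum>k\<in>Y. fps_const (c k) * fps_X ^ k"
  have nth: "fps_nth (?s Y) n = (if n \<in> Y then c n else 0)" if "finite Y" for Y n
  proof -
    have "fps_nth (?s Y) n = (\<Sum>k\<in>Y. if n = k then c k else 0)"
      by (auto simp: fps_sum_nth intro!: sum.cong)
    also have "\<dots> = (if n \<in> Y then c n else 0)"
      using that by simp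
    finally show ?thesis .
  qed
  show ?thesis
    unfolding has_sum_def tendsto_fps_iff
  proof
    fix n
    show "\<forall>\<^sub>F Y in finite_subsets_at_top A. fps_nth (?s Y) n = fps_nth ?F n"
      unfolding eventually_finite_subsets_at_top
      by (rule exI[of _ "A \<inter> {n}"]) (auto simp: nth)
  qed
qed

end

theory Submission
  imports Defs
begin

text \<open>
  Deleting the block that contains a distinguished element yields a recurrence for the number of
  partitions into \<open>k + 1\<close> blocks. For the exponential generating functions \<open>E\<^sub>k\<close> of the columns it
  reads \<open>E\<^sub>k\<^sub>+\<^sub>1' = f' E\<^sub>k\<close>, which is also satisfied by \<open>f\<^sup>k / k!\<close>.
\<close>

text \<open>Arbitrary ground sets are needed because deleting a block from a partition of
  \<open>{1..n}\<close> leaves a set that is in general no longer an initial segment.\<close>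

definition block_partitions :: "nat set \<Rightarrow> 'b set \<Rightarrow> nat \<Rightarrow> 'b set set set" where
  "block_partitions S A k = {P. partition_on A P \<and> card P = k \<and> (\<forall>B\<in>P. card B \<in> S)}"

lemma finite_block_partitions: "finite A \<Longrightarrow> finite (block_partitions S A k)"
  by (rule finite_subset[OF _ finitely_many_partition_on[of A]]) (auto simp: block_partitions_def)

lemma restricted_Stirling_eq: "restricted_Stirling S n k = card (block_partitions S {1..n} k)"
  by (simp add: restricted_Stirling_def block_partitions_def)

lemma image_block_partitions:
  assumes "inj_on h A" "P \<in> block_partitions S A k"
  shows "(`) h ` P \<in> block_partitions S (h ` A) k"
proof -
  have P: "partition_on A P" "card P = k" "\<forall>B\<in>P. card B \<in> S"
    using assms(2) by (auto simp: block_partitions_def)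
  have sub: "\<Union>P = A" using P(1) by (simp add: partition_on_def)
  have inj: "inj_on ((`) h) P"
    using assms(1) sub inj_on_image by blast
  have "partition_on (h ` A) ((`) h ` P)"
    using partition_on_inj_image[OF P(1) assms(1)] P(1) by (simp add: partition_on_def image_iff)
  moreover have "card (h ` B) = card B" if "B \<in> P" for B
    using that sub assms(1) by (intro card_image) (auto intro: inj_on_subset)
  ultimately show ?thesis
    using P inj by (auto simp: block_partitions_def card_image)
qed

lemma card_block_partitions_le:
  assumes "finite A" "inj_on h A"
  shows "card (block_partitions S A k) \<le> card (block_partitions S (h ` A) k)"
proof (rule card_inj_on_le)
  show "(`) ((`) h) ` block_partitions S A k \<subseteq> block_partitions S (h ` A) k"
    using image_block_partitions[OF assms(2)] by blast
  show "finite (block_partitions S (h ` A) k)"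
    using assms(1) by (simp add: finite_block_partitions)
  \<comment> \<open>A partition of \<open>A\<close> lies in \<open>Pow (Pow A)\<close>, so
    injectivity of \<open>h\<close> on \<open>A\<close> is lifted twice, from points to blocks and
    from blocks to partitions.\<close>
  have "inj_on ((`) ((`) h)) (Pow (Pow A))"
    using assms(2) by (intro inj_on_image_Pow)
  then show "inj_on ((`) ((`) h)) (block_partitions S A k)"
    by (rule inj_on_subset) (auto simp: block_partitions_def partition_on_def)
qed

lemma card_block_partitions_cong:
  assumes "finite A" "finite B" "card A = card B"
  shows "card (block_partitions S A k) = card (block_partitions S B k)"
proof -
  obtain h where h: "bij_betw h A B"
    using assms finite_same_card_bij by blast
  show ?thesis
    \<comment> \<open>Equality comes from two inequalities, one transported along \<open>h\<close>
      and one along its inverse.\<close>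
    using card_block_partitions_le[of A h S k] h
      card_block_partitions_le[of B "inv_into A h" S k] bij_betw_inv_into[OF h] assms
    by (auto simp: bij_betw_def intro!: antisym)
qed

lemma card_block_partitions_eq:
  "finite A \<Longrightarrow> card (block_partitions S A k) = restricted_Stirling S (card A) k"
  unfolding restricted_Stirling_eq by (rule card_block_partitions_cong) auto

text \<open>A partition of \<open>insert a A\<close> amounts to a choice of the companions
  \<open>B\<close> of \<open>a\<close> in its block together with a partition \<open>Q\<close> of
  what remains. The block of \<open>a\<close> has size \<open>Suc (card B)\<close>, whence the
  condition on \<open>B\<close>.\<close>

lemma block_partitions_insert:
  assumes "finite A" "a \<notin> A"
  shows "bij_betw (\<lambda>(B, Q). insert (insert a B) Q)
           (SIGMA B:{B \<in> Pow A. Suc (card B) \<in> S}. block_partitions S (A - B) k)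
           (block_partitions S (insert a A) (Suc k))"
proof (rule bij_betwI[where g = "\<lambda>P. ((THE B. B \<in> P \<and> a \<in> B) - {a}, {B\<in>P. a \<notin> B})"])
  show "(\<lambda>(B, Q). insert (insert a B) Q)
    \<in> (SIGMA B:{B \<in> Pow A. Suc (card B) \<in> S}. block_partitions S (A - B) k)
      \<rightarrow> block_partitions S (insert a A) (Suc k)"
  proof clarsimp
    fix B Q assume B: "B \<subseteq> A" "Suc (card B) \<in> S" and Q: "Q \<in> block_partitions S (A - B) k"
    have part: "partition_on (A - B) Q" and Q': "card Q = k" "\<forall>C\<in>Q. card C \<in> S"
      using Q by (auto simp: block_partitions_def)
    have fin: "finite Q"
      using finite_elements[OF _ part] assms(1) by simp
    \<comment> \<open>The blocks of \<open>Q\<close> avoid \<open>a\<close>, so the added block is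
      new and the number of blocks really increases by one.\<close>
    have notin: "insert a B \<notin> Q"
      using part assms(2) by (auto simp: partition_on_def)
    have "partition_on (insert a A) (insert (insert a B) Q)"
      using part B assms(2) by (subst partition_on_insert[OF _ ]) (auto simp: disjnt_def partition_on_def)
    moreover have "card (insert a B) = Suc (card B)"
      using B assms finite_subset by (subst card_insert_disjoint) auto
    ultimately show "insert (insert a B) Q \<in> block_partitions S (insert a A) (Suc k)"
      using notin fin Q' B by (auto simp: block_partitions_def)
  qed
next
  \<comment> \<open>Disjointness of blocks makes the block of \<open>a\<close> unique, so the
    description in the inverse map is well defined.\<close>
  have the: "(THE B. B \<in> P \<and> a \<in> B) = C"
    if "partition_on (insert a A) P" "C \<in> P" "a \<in> C" for P C
    using that by (intro the_equality) (auto dest: partition_onD2 disjointD)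
  show "(\<lambda>P. ((THE B. B \<in> P \<and> a \<in> B) - {a}, {B\<in>P. a \<notin> B}))
    \<in> block_partitions S (insert a A) (Suc k)
      \<rightarrow> (SIGMA B:{B \<in> Pow A. Suc (card B) \<in> S}. block_partitions S (A - B) k)"
  proof
    fix P assume "P \<in> block_partitions S (insert a A) (Suc k)"
    then have P: "partition_on (insert a A) P" "card P = Suc k" "\<forall>C\<in>P. card C \<in> S"
      by (auto simp: block_partitions_def)
    obtain C where C: "C \<in> P" "a \<in> C"
      using P(1) by (auto simp: partition_on_def)
    have CA: "C \<subseteq> insert a A" using P(1) C by (auto simp: partition_on_def)
    have rest: "{B\<in>P. a \<notin> B} = P - {C}"
      using P(1) C by (auto simp: partition_on_def disjoint_def)
    have dis: "D \<inter> C = {}" if "D \<in> P - {C}" for D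
      using that C(1) disjointD[OF partition_onD2[OF P(1)], of D C] by simp
    have "\<Union>(P - {C}) = insert a A - C"
      unfolding partition_onD1[OF P(1)] using C(1) dis by fast
    then have "partition_on (insert a A - C) (P - {C})"
      using P(1) by (simp add: partition_on_def disjoint_def)
    moreover have "insert a A - C = A - (C - {a})"
      using C assms(2) by auto
    moreover have "Suc (card (C - {a})) = card C"
      using C CA assms(1) by (meson card_Suc_Diff1 finite_insert finite_subset)
    ultimately show "((THE B. B \<in> P \<and> a \<in> B) - {a}, {B\<in>P. a \<notin> B})
        \<in> (SIGMA B:{B \<in> Pow A. Suc (card B) \<in> S}. block_partitions S (A - B) k)"
      using P C CA unfolding the[OF P(1) C] rest by (auto simp: block_partitions_def)
  qed
  fix P assume "P \<in> block_partitions S (insert a A) (Suc k)"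
  then have P: "partition_on (insert a A) P"
    by (auto simp: block_partitions_def)
  obtain C where C: "C \<in> P" "a \<in> C"
    using P by (auto simp: partition_on_def)
  have rest: "{B\<in>P. a \<notin> B} = P - {C}"
    using P C by (auto simp: partition_on_def disjoint_def)
  show "(case ((THE B. B \<in> P \<and> a \<in> B) - {a}, {B\<in>P. a \<notin> B}) of
      (B, Q) \<Rightarrow> insert (insert a B) Q) = P"
    using C unfolding the[OF P C] rest by (simp add: insert_absorb)
next
  fix x assume x: "x \<in> (SIGMA B:{B \<in> Pow A. Suc (card B) \<in> S}. block_partitions S (A - B) k)"
  obtain B Q where [simp]: "x = (B, Q)" by fastforce
  have B: "a \<notin> B" and Q: "\<And>C. C \<in> Q \<Longrightarrow> a \<notin> C"
    using x assms(2) by (auto simp: block_partitions_def partition_on_def)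
  have "(THE C. C \<in> insert (insert a B) Q \<and> a \<in> C) = insert a B"
    using Q by (intro the_equality) auto
  then show "((THE C. C \<in> (case x of (B, Q) \<Rightarrow> insert (insert a B) Q) \<and> a \<in> C) - {a},
      {C \<in> (case x of (B, Q) \<Rightarrow> insert (insert a B) Q). a \<notin> C}) = x"
    using B Q by auto
qed

lemma sum_Pow_card:
  fixes g :: "nat \<Rightarrow> nat"
  assumes "finite A"
  shows "(\<Sum>B\<in>Pow A. g (card B)) = (\<Sum>j\<le>card A. (card A choose j) * g j)"
proof -
  have "(\<Sum>B\<in>Pow A. g (card B)) = (\<Sum>j\<le>card A. \<Sum>B\<in>{B \<in> Pow A. card B = j}. g (card B))"
    using assms by (intro sum.group[symmetric]) (auto intro: card_mono)
  also have "\<dots> = (\<Sum>j\<le>card A. (card A choose j) * g j)"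
    using n_subsets[OF assms] by (intro sum.cong) auto
  finally show ?thesis .
qed

text \<open>The distinguished element is \<open>Suc n\<close>, and \<open>j\<close> counts its
  companions: its block has size \<open>Suc j\<close>, the companions can be chosen in
  \<open>n choose j\<close> ways, and \<open>n - j\<close> elements remain for the other
  \<open>k\<close> blocks.\<close>

lemma restricted_Stirling_Suc_Suc:
  "restricted_Stirling S (Suc n) (Suc k) =
     (\<Sum>j\<le>n. (n choose j) * (if Suc j \<in> S then restricted_Stirling S (n - j) k else 0))"
proof -
  let ?A = "{1..n}"
  have "restricted_Stirling S (Suc n) (Suc k) = card (block_partitions S (insert (Suc n) ?A) (Suc k))"
    by (subst card_block_partitions_eq) auto
  also have "\<dots> = card (SIGMA B:{B \<in> Pow ?A. Suc (card B) \<in> S}. block_partitions S (?A - B) k)"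
    by (rule bij_betw_same_card[symmetric], rule block_partitions_insert) auto
  also have "\<dots> = (\<Sum>B\<in>{B \<in> Pow ?A. Suc (card B) \<in> S}. card (block_partitions S (?A - B) k))"
    by (intro card_SigmaI) (auto intro: finite_block_partitions)
  also have "\<dots> = (\<Sum>B\<in>{B \<in> Pow ?A. Suc (card B) \<in> S}. restricted_Stirling S (n - card B) k)"
    by (intro sum.cong refl, subst card_block_partitions_eq)
       (auto simp: card_Diff_subset finite_subset)
  also have "\<dots> = (\<Sum>B\<in>Pow ?A. if Suc (card B) \<in> S then restricted_Stirling S (n - card B) k else 0)"
    by (intro sum.inter_filter) auto
  also have "\<dots> = (\<Sum>j\<le>n. (n choose j) * (if Suc j \<in> S then restricted_Stirling S (n - j) k else 0))"
    by (subst sum_Pow_card) auto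
  finally show ?thesis .
qed

lemma restricted_Stirling_0_right: "restricted_Stirling S n 0 = (if n = 0 then 1 else 0)"
proof -
  \<comment> \<open>\<open>card\<close> is also 0 on infinite sets; \<open>finite_elements\<close>
    rules these out, leaving only the empty family, which covers \<open>{1..n}\<close> just when
    \<open>n = 0\<close>.\<close>
  have "block_partitions S {1..n} 0 = (if n = 0 then {{}} else {})"
    using finite_elements[of "{1..n}"]
    by (auto simp: block_partitions_def partition_on_def card_eq_0_iff)
  then show ?thesis by (simp add: restricted_Stirling_eq)
qed

lemma restricted_Stirling_0_Suc: "restricted_Stirling S 0 (Suc k) = 0"
  by (auto simp: restricted_Stirling_def partition_on_empty)

lemma egf_restricted_Stirling:
  fixes S :: "nat set"
  defines "f \<equiv> Abs_fps (\<lambda>n. if n \<in> S then 1 / fact n else 0 :: 'a::field_char_0)"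
  assumes "0 \<notin> S"
  shows "egf (\<lambda>n. of_nat (restricted_Stirling S n k)) = f ^ k * fps_const (1 / fact k)"
proof (induction k)
  case 0
  show ?case
    by (auto simp: egf_def restricted_Stirling_0_right fps_eq_iff)
next
  case (Suc k)
  let ?E = "\<lambda>k. egf (\<lambda>n. of_nat (restricted_Stirling S n k)) :: 'a fps"
  have "fps_deriv (?E (Suc k)) = fps_deriv f * ?E k"
  proof (rule fps_ext)
    fix n
    have "fps_nth (fps_deriv (?E (Suc k))) n = of_nat (restricted_Stirling S (Suc n) (Suc k)) / fact n"
      by (simp add: egf_def field_simps del: of_nat_Suc)
    \<comment> \<open>Since \<open>n choose j\<close> over \<open>fact n\<close> is the product of
      the reciprocals of \<open>fact j\<close> and \<open>fact (n - j)\<close>, the recurrence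
      becomes a Cauchy product. The coefficient of \<open>fps_deriv f\<close> at \<open>j\<close> is
      (j+1)/(j+1)! = 1/j! when \<open>Suc j\<close> is in \<open>S\<close>, and 0 otherwise.\<close>
    also have "\<dots> = (\<Sum>j=0..n. fps_nth (fps_deriv f) j * fps_nth (?E k) (n - j))"
      unfolding restricted_Stirling_Suc_Suc of_nat_sum sum_divide_distrib atMost_atLeast0
      by (intro sum.cong refl) (auto simp: f_def egf_def binomial_fact field_simps simp del: of_nat_Suc)
    finally show "fps_nth (fps_deriv (?E (Suc k))) n = fps_nth (fps_deriv f * ?E k) n"
      by (simp add: fps_mult_nth)
  qed
  also have "\<dots> = fps_deriv (f ^ Suc k * fps_const (1 / fact (Suc k)))"
  proof -
    have "of_nat (Suc k) * (1 / fact (Suc k)) = (1 / fact k :: 'a)"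
      by (simp add: field_simps del: of_nat_Suc)
    then have "fps_const (of_nat (Suc k)) * fps_const (1 / fact (Suc k)) = (fps_const (1 / fact k) :: 'a fps)"
      by (simp only: fps_const_mult)
    then show ?thesis
      unfolding Suc.IH fps_deriv_mult fps_deriv_power by (simp add: mult_ac del: fps_const_mult of_nat_Suc fact_Suc)
  qed
  finally have "\<exists>c. ?E (Suc k) = fps_const c + f ^ Suc k * fps_const (1 / fact (Suc k))"
    by (simp only: fps_deriv_eq_iff) blast
  \<comment> \<open>The constant of integration vanishes: the empty set has no partition into
    \<open>Suc k\<close> blocks, and \<open>f\<close> has zero constant term because 0 is not in
    \<open>S\<close>.\<close>
  moreover have "fps_nth (?E (Suc k)) 0 = fps_nth (f ^ Suc k * fps_const (1 / fact (Suc k))) 0"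
    using assms(2) by (simp add: egf_def restricted_Stirling_0_Suc f_def)
  ultimately show ?case
    by (auto simp del: power_Suc fact_Suc)
qed

theorem theorem2:
  fixes S :: "nat set"
    and M :: "nat \<Rightarrow> nat \<Rightarrow> 'a::field_char_0"
    and f :: "'a fps"
  assumes "S \<subseteq> {0<..}" and "1 \<in> S"
    and "M = restricted_Stirling_matrix S"
    and "f = fps_X + (\<Sum>\<^sub>\<infinity>k\<in>S - {1}. fps_const (1 / fact k) * fps_X ^ k)"
  shows "exp_riordan_matrix M \<and> riordan_pair 1 f \<and> M = exp_riordan 1 f"
proof -
  have "f = fps_X + Abs_fps (\<lambda>n. if n \<in> S - {1} then 1 / fact n else 0)"
    unfolding assms(4) by (subst infsumI[OF has_sum_fps_monomials]) rule
  then have f: "f = Abs_fps (\<lambda>n. if n \<in> S then 1 / fact n else 0)"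
    \<comment> \<open>As 1 is in \<open>S\<close>, the separate summand \<open>fps_X\<close>
      supplies exactly the missing coefficient 1/1! at index 1.\<close>
    using assms(2) by (auto simp: fps_eq_iff)
  have "0 \<notin> S"
    using assms(1) by auto
  then have egf: "\<forall>k. egf (\<lambda>n. M n k) = 1 * f ^ k * fps_const (1 / fact k)"
    by (simp add: egf_restricted_Stirling f assms(3) restricted_Stirling_matrix_def)
  have pair: "riordan_pair 1 f"
    using assms(2) \<open>0 \<notin> S\<close> by (simp add: riordan_pair_def f)
  have M: "M = exp_riordan 1 f"
    by (rule eq_exp_riordan_iff[THEN iffD2, OF egf])
  \<comment> \<open>Lower triangularity: \<open>f\<close> has no constant term, so
    \<open>f ^ k\<close> has no terms of degree below \<open>k\<close>.\<close>
  have "M n k = 0" if "n < k" for n k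
    using that startsby_zero_power_prefix[of f k] pair
    by (simp add: M exp_riordan_def riordan_pair_def)
  then have "exp_riordan_matrix M"
    unfolding exp_riordan_matrix_def using pair egf by blast
  then show ?thesis
    using pair M by blast
qed

end
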